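(* Let $(A,\Phi)$ be a $\mathcal{C}^{\infty}$-ring and let $R \subseteq A \times A$ be a $\mathcal{C}^{\infty}$-congruence on $(A,\Phi)$. For every $\mathcal{C}^{\infty}$-ring $(B,\Psi)$ and every $\mathcal{C}^{\infty}$-homomorphism $\varphi: (A,\Phi) \to (B,\Psi)$ such that $R \subseteq \ker(\varphi)$, that is, such that $(a,a') \in R \Rightarrow \varphi(a) = \varphi(a')$, there is a unique $\mathcal{C}^{\infty}$-homomorphism $\widetilde{\varphi}: \left( A/R, \overline{\Phi}\right) \rightarrow (B,\Psi)$ such that $\widetilde{\varphi} \circ q = \varphi$, where $q: A \to A/R$, $a \mapsto \overline{a}$, is the quotient map and $\overline{\Phi}$ is the canonical $\mathcal{C}^{\infty}$-structure induced on the quotient $A/R$.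
   Context: $\mathbb{N}=\{0,1,2,\dots\}$. A $\mathcal{C}^{\infty}$-structure is a pair $(A,\Phi)$, where $A$ is a set and $\Phi$ assigns to each $n\in\mathbb{N}$ and each smooth function $f\in\mathcal{C}^{\infty}(\mathbb{R}^n,\mathbb{R})$ a function $\Phi(f):A^n\to A$. It is a $\mathcal{C}^{\infty}$-ring if (1) for each $n$ and $k\le n$, the projection $p_k:\mathbb{R}^n\to\mathbb{R}$ onto the $k$-th coordinate is sent to the projection $\pi_k:A^n\to A$ onto the $k$-th coordinate; and (2) whenever $f\in\mathcal{C}^{\infty}(\mathbb{R}^n,\mathbb{R})$, $g_1,\dots,g_n,h\in\mathcal{C}^{\infty}(\mathbb{R}^k,\mathbb{R})$ and $h=f\circ(g_1,\dots,g_n)$, then $\Phi(h)=\Phi(f)\circ(\Phi(g_1),\dots,\Phi(g_n))$. A $\mathcal{C}^{\infty}$-homomorphism $\varphi:(A,\Phi)\to(B,\Psi)$ is a function $\varphi:A\to B$ with $\varphi(\Phi(f)(a_1,\dots,a_n))=\Psi(f)(\varphi(a_1),\dots,\varphi(a_n))$ for all $n$, all $f\in\mathcal{C}^{\infty}(\mathbb{R}^n,\mathbb{R})$ and all $a_i\in A$. A $\mathcal{C}^{\infty}$-congruence on $(A,\Phi)$ is an equivalence relation $R\subseteq A\times A$ such that for all $n$, $f\in\mathcal{C}^{\infty}(\mathbb{R}^n,\mathbb{R})$ and $(x_1,y_1),\dots,(x_n,y_n)\in R$ one has $(\Phi(f)(x_1,\dots,x_n),\Phi(f)(y_1,\dots,y_n))\in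 R$. The induced structure on $A/R=\{\overline a\mid a\in A\}$ is $\overline{\Phi}(f)(\overline{a_1},\dots,\overline{a_n})=\overline{\Phi(f)(a_1,\dots,a_n)}$, which is well defined. For a $\mathcal{C}^{\infty}$-homomorphism $\varphi$, $\ker(\varphi)=\{(a,a')\in A\times A\mid\varphi(a)=\varphi(a')\}$. *)

theory Defs
  imports "HOL-Analysis.Analysis"
begin

text \<open>
  Points of \<open>A\<^sup>n\<close> are functions on the index set \<open>{..<n}\<close> (coordinates are numbered from \<open>0\<close>),
  extended by \<open>undefined\<close>. In particular \<open>A\<^sup>0\<close> is a singleton. The topology on \<open>\<real>\<^sup>n\<close> is the
  subspace topology from the product topology on \<^typ>\<open>nat \<Rightarrow> real\<close>; as the coordinates outside
  \<open>{..<n}\<close> are constant, it is the usual one.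
\<close>

definition cart_power :: "'a set \<Rightarrow> nat \<Rightarrow> (nat \<Rightarrow> 'a) set" where
  "cart_power A n = ({..<n} \<rightarrow>\<^sub>E A)"

abbreviation R_pow :: "nat \<Rightarrow> (nat \<Rightarrow> real) set" where
  "R_pow n \<equiv> cart_power UNIV n"

definition partial_deriv :: "nat \<Rightarrow> ((nat \<Rightarrow> real) \<Rightarrow> real) \<Rightarrow> (nat \<Rightarrow> real) \<Rightarrow> real" where
  "partial_deriv i f x = deriv (\<lambda>t. f (x(i := t))) (x i)"

fun times_cont_diff :: "nat \<Rightarrow> nat \<Rightarrow> ((nat \<Rightarrow> real) \<Rightarrow> real) \<Rightarrow> bool" where
  "times_cont_diff 0 n f \<longleftrightarrow> continuous_on (R_pow n) f"
| "times_cont_diff (Suc r) n f \<longleftrightarrow>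
     continuous_on (R_pow n) f \<and>
     (\<forall>i<n. (\<forall>x\<in>R_pow n. (\<lambda>t. f (x(i := t))) differentiable (at (x i))) \<and>
            times_cont_diff r n (partial_deriv i f))"

text \<open>
  A member of \<open>C_infinity n\<close> is \<open>undefined\<close> off \<open>\<real>\<^sup>n\<close>, so that equal functions on \<open>\<real>\<^sup>n\<close> are equal
  as terms. The arity \<open>n\<close> remains a separate argument of a structure below: the carriers \<open>\<real>\<^sup>n\<close>
  for different \<open>n\<close> need not be disjoint in this encoding.
\<close>

definition C_infinity :: "nat \<Rightarrow> ((nat \<Rightarrow> real) \<Rightarrow> real) set" where
  "C_infinity n = {f \<in> R_pow n \<rightarrow>\<^sub>E UNIV. \<forall>r. times_cont_diff r n f}"

type_synonym 'a operations = "nat \<Rightarrow> ((nat \<Rightarrow> real) \<Rightarrow> real) \<Rightarrow> (nat \<Rightarrow> 'a) \<Rightarrow> 'a"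

definition C_infinity_structure :: "'a set \<Rightarrow> 'a operations \<Rightarrow> bool" where
  "C_infinity_structure A \<Phi> \<longleftrightarrow>
     (\<forall>n. \<forall>f\<in>C_infinity n. \<Phi> n f \<in> cart_power A n \<rightarrow>\<^sub>E A)"

definition C_infinity_ring :: "'a set \<Rightarrow> 'a operations \<Rightarrow> bool" where
  "C_infinity_ring A \<Phi> \<longleftrightarrow>
     C_infinity_structure A \<Phi> \<and>
     (\<forall>n. \<forall>k<n. \<Phi> n (\<lambda>x\<in>R_pow n. x k) = (\<lambda>a\<in>cart_power A n. a k)) \<and>
     (\<forall>n k f g h.
        f \<in> C_infinity n \<longrightarrow> (\<forall>i<n. g i \<in> C_infinity k) \<longrightarrow> h \<in> C_infinity k \<longrightarrow>
        h = (\<lambda>x\<in>R_pow k. f (\<lambda>i\<in>{..<n}. g i x)) \<longrightarrow>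
        \<Phi> k h = (\<lambda>a\<in>cart_power A k. \<Phi> n f (\<lambda>i\<in>{..<n}. \<Phi> k (g i) a)))"

definition C_infinity_hom ::
    "'a set \<Rightarrow> 'a operations \<Rightarrow> 'b set \<Rightarrow> 'b operations \<Rightarrow> ('a \<Rightarrow> 'b) \<Rightarrow> bool" where
  "C_infinity_hom A \<Phi> B \<Psi> \<phi> \<longleftrightarrow>
     \<phi> \<in> A \<rightarrow>\<^sub>E B \<and>
     (\<forall>n. \<forall>f\<in>C_infinity n. \<forall>a\<in>cart_power A n.
        \<phi> (\<Phi> n f a) = \<Psi> n f (\<lambda>i\<in>{..<n}. \<phi> (a i)))"

definition C_infinity_congruence ::
    "'a set \<Rightarrow> 'a operations \<Rightarrow> ('a \<times> 'a) set \<Rightarrow> bool" where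
  "C_infinity_congruence A \<Phi> R \<longleftrightarrow>
     equiv A R \<and>
     (\<forall>n. \<forall>f\<in>C_infinity n. \<forall>x\<in>cart_power A n. \<forall>y\<in>cart_power A n.
        (\<forall>i<n. (x i, y i) \<in> R) \<longrightarrow> (\<Phi> n f x, \<Phi> n f y) \<in> R)"

definition hom_kernel :: "'a set \<Rightarrow> ('a \<Rightarrow> 'b) \<Rightarrow> ('a \<times> 'a) set" where
  "hom_kernel A \<phi> = {(a, a') \<in> A \<times> A. \<phi> a = \<phi> a'}"

definition quotient_proj :: "'a set \<Rightarrow> ('a \<times> 'a) set \<Rightarrow> 'a \<Rightarrow> 'a set" where
  "quotient_proj A R = (\<lambda>a\<in>A. R `` {a})"

definition quotient_operations ::
    "'a set \<Rightarrow> 'a operations \<Rightarrow> ('a \<times> 'a) set \<Rightarrow> 'a set operations" where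
  "quotient_operations A \<Phi> R n f =
     (\<lambda>X\<in>cart_power (A // R) n.
        THE Y. \<exists>a\<in>cart_power A n.
          X = (\<lambda>i\<in>{..<n}. quotient_proj A R (a i)) \<and> Y = quotient_proj A R (\<Phi> n f a))"

text \<open>The description in \<open>quotient_operations\<close> denotes: the operations are well defined.\<close>

lemma quotient_operations_eq:
  assumes str: "C_infinity_structure A \<Phi>"
    and cong: "C_infinity_congruence A \<Phi> R"
    and f: "f \<in> C_infinity n"
    and a: "a \<in> cart_power A n"
  shows "quotient_operations A \<Phi> R n f (\<lambda>i\<in>{..<n}. quotient_proj A R (a i)) =
         quotient_proj A R (\<Phi> n f a)"
proof -
  have eq: "equiv A R"
    using cong by (simp add: C_infinity_congruence_def)
  have mem: "x i \<in> A" if "x \<in> cart_power A n" "i < n" for x i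
    using that by (auto simp: cart_power_def)
  have cl: "\<Phi> n f x \<in> A" if "x \<in> cart_power A n" for x
    using str f that by (auto simp: C_infinity_structure_def)
  let ?X = "\<lambda>i\<in>{..<n}. quotient_proj A R (a i)"
  have X: "?X \<in> cart_power (A // R) n"
    using mem[OF a] by (auto simp: cart_power_def quotient_proj_def intro!: quotientI)
  have "quotient_proj A R (\<Phi> n f b) = quotient_proj A R (\<Phi> n f a)"
    if b: "b \<in> cart_power A n" and Xb: "?X = (\<lambda>i\<in>{..<n}. quotient_proj A R (b i))" for b
  proof -
    have "(b i, a i) \<in> R" if i: "i < n" for i
    proof -
      have "quotient_proj A R (a i) = quotient_proj A R (b i)"
        using fun_cong[OF Xb, of i] i by simp
      then show ?thesis
        using mem[OF a i] mem[OF b i] eq_equiv_class[OF _ eq, of "b i" "a i"]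
        by (simp add: quotient_proj_def)
    qed
    then have "(\<Phi> n f b, \<Phi> n f a) \<in> R"
      using cong f a b by (auto simp: C_infinity_congruence_def)
    then show ?thesis
      using cl[OF a] cl[OF b] equiv_class_eq[OF eq] by (simp add: quotient_proj_def)
  qed
  then have "(THE Y. \<exists>b\<in>cart_power A n. ?X = (\<lambda>i\<in>{..<n}. quotient_proj A R (b i)) \<and>
      Y = quotient_proj A R (\<Phi> n f b)) = quotient_proj A R (\<Phi> n f a)"
    using a by (intro the_equality) blast+
  then show ?thesis
    using X by (simp add: quotient_operations_def)
qed

end

theory Submission
  imports Defs
begin

text \<open>Since \<open>\<phi>\<close> is constant on the classes of \<open>R\<close>, it factors
  through the surjection \<open>q\<close> as a map of sets, in exactly one way
  (\<open>quotient_map_unique_lift\<close>). Compatibility with the operations then comes for free: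
  every tuple of classes is the image under \<open>q\<close> of a tuple of representatives, the
  quotient operations are computed on representatives, and \<open>\<phi>\<close> is a homomorphism
  (\<open>C_infinity_hom_of_compose\<close>). Existence and uniqueness among homomorphisms thus
  reduce to existence and uniqueness among maps.\<close>

text \<open>Brings an arbitrary argument of a quotient operation into the form that
  \<open>quotient_operations_eq\<close> evaluates.\<close>

lemma cart_power_quotient_lift:
  assumes "X \<in> cart_power (A // R) n"
  obtains a where "a \<in> cart_power A n" "X = (\<lambda>i\<in>{..<n}. quotient_proj A R (a i))"
proof -
  have "\<exists>a. a \<in> A \<and> X i = quotient_proj A R a" if "i < n" for i
  proof -
    have "X i \<in> A // R"
      using assms that by (auto simp: cart_power_def)
    then show ?thesis
      by (rule quotientE) (auto simp: quotient_proj_def)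
  qed
  then obtain a where a: "\<And>i. i < n \<Longrightarrow> a i \<in> A \<and> X i = quotient_proj A R (a i)"
    by metis
  \<comment> \<open>The chosen \<open>a\<close> is arbitrary off \<open>{..<n}\<close>; restricting
    it makes it a point of the power, and both sides of the equation for \<open>X\<close> are
    \<open>undefined\<close> there.\<close>
  show ?thesis
  proof
    show "(\<lambda>i\<in>{..<n}. a i) \<in> cart_power A n"
      using a by (auto simp: cart_power_def)
    show "X = (\<lambda>i\<in>{..<n}. quotient_proj A R ((\<lambda>i\<in>{..<n}. a i) i))"
    proof
      fix i
      show "X i = (\<lambda>i\<in>{..<n}. quotient_proj A R ((\<lambda>i\<in>{..<n}. a i) i)) i"
        using a[of i] assms by (auto simp: cart_power_def PiE_def extensional_def)
    qed
  qed
qed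

text \<open>The purely set-theoretic part: a value on a class is read off from any representative,
  and surjectivity of \<open>q\<close> leaves no other choice.\<close>

lemma quotient_map_unique_lift:
  assumes eq: "equiv A R" and \<phi>: "\<phi> \<in> A \<rightarrow>\<^sub>E B" and ker: "R \<subseteq> hom_kernel A \<phi>"
  shows "\<exists>!\<phi>'. \<phi>' \<in> A // R \<rightarrow>\<^sub>E B \<and> compose A \<phi>' (quotient_proj A R) = \<phi>"
proof (rule ex_ex1I)
  define \<phi>' where "\<phi>' = (\<lambda>X\<in>A // R. \<phi> (SOME a. a \<in> X))"
  have eval: "\<phi>' (R `` {a}) = \<phi> a" if "a \<in> A" for a
  proof -
    \<comment> \<open>By reflexivity the class of \<open>a\<close> contains \<open>a\<close>, so the
      selected element is \<open>R\<close>-related to \<open>a\<close>; the kernel hypothesis then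
      gives both the same image under \<open>\<phi>\<close>.\<close>
    have "(SOME b. b \<in> R `` {a}) \<in> R `` {a}"
      using equiv_class_self[OF eq that] by (rule someI)
    then show ?thesis
      using that ker by (auto simp: \<phi>'_def quotientI hom_kernel_def)
  qed
  have "\<phi>' \<in> A // R \<rightarrow>\<^sub>E B"
  proof (rule PiE_I)
    show "\<phi>' X \<in> B" if "X \<in> A // R" for X
      using that by (rule quotientE) (use \<phi> eval in auto)
  qed (simp add: \<phi>'_def)
  moreover have "compose A \<phi>' (quotient_proj A R) = \<phi>"
    using \<phi> by (auto simp: compose_def quotient_proj_def eval PiE_def extensional_def)
  ultimately show "\<exists>\<phi>'. \<phi>' \<in> A // R \<rightarrow>\<^sub>E B \<and> compose A \<phi>' (quotient_proj A R) = \<phi>"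
    by blast
next
  fix f g
  assume f: "f \<in> A // R \<rightarrow>\<^sub>E B \<and> compose A f (quotient_proj A R) = \<phi>"
    and g: "g \<in> A // R \<rightarrow>\<^sub>E B \<and> compose A g (quotient_proj A R) = \<phi>"
  have "f (R `` {a}) = g (R `` {a})" if "a \<in> A" for a
    using f g that compose_eq[OF that, of f "quotient_proj A R"]
      compose_eq[OF that, of g "quotient_proj A R"] by (simp add: quotient_proj_def)
  then show "f = g"
    using f g by (intro PiE_ext[of f "A // R" "\<lambda>_. B" g]) (auto elim!: quotientE)
qed

text \<open>A map whose composite with a surjective homomorphism is a homomorphism is itself one;
  here the surjection is \<open>q\<close>.\<close>

lemma C_infinity_hom_of_compose:
  assumes A: "C_infinity_structure A \<Phi>" and R: "C_infinity_congruence A \<Phi> R"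
    and hom: "C_infinity_hom A \<Phi> B \<Psi> \<phi>"
    and \<phi>': "\<phi>' \<in> A // R \<rightarrow>\<^sub>E B" "compose A \<phi>' (quotient_proj A R) = \<phi>"
  shows "C_infinity_hom (A // R) (quotient_operations A \<Phi> R) B \<Psi> \<phi>'"
  unfolding C_infinity_hom_def
proof (intro conjI allI ballI \<phi>'(1))
  fix n f X
  assume f: "f \<in> C_infinity n" and "X \<in> cart_power (A // R) n"
  then obtain a where a: "a \<in> cart_power A n"
    and X: "X = (\<lambda>i\<in>{..<n}. quotient_proj A R (a i))"
    by (blast elim: cart_power_quotient_lift)
  have eval: "\<phi>' (quotient_proj A R b) = \<phi> b" if "b \<in> A" for b
    using \<phi>'(2) compose_eq[OF that, of \<phi>' "quotient_proj A R"] by simp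
  \<comment> \<open>Closure of \<open>A\<close> under the operation is what allows
    \<open>eval\<close> to be applied to the result.\<close>
  have "\<Phi> n f a \<in> A"
    using A f a by (auto simp: C_infinity_structure_def)
  then have "\<phi>' (quotient_operations A \<Phi> R n f X) = \<phi> (\<Phi> n f a)"
    by (simp add: X quotient_operations_eq[OF A R f a] eval)
  also have "\<dots> = \<Psi> n f (\<lambda>i\<in>{..<n}. \<phi> (a i))"
    using hom f a by (simp add: C_infinity_hom_def)
  also have "(\<lambda>i\<in>{..<n}. \<phi> (a i)) = (\<lambda>i\<in>{..<n}. \<phi>' (X i))"
  proof (rule restrict_ext)
    fix i assume "i \<in> {..<n}"
    moreover from this have "a i \<in> A"
      using a by (auto simp: cart_power_def)
    ultimately show "\<phi> (a i) = \<phi>' (X i)"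
      by (simp add: X eval)
  qed
  finally show "\<phi>' (quotient_operations A \<Phi> R n f X) = \<Psi> n f (\<lambda>i\<in>{..<n}. \<phi>' (X i))" .
qed

theorem theorem3:
  fixes A :: "'a set" and \<Phi> :: "'a operations" and R :: "('a \<times> 'a) set"
    and B :: "'b set" and \<Psi> :: "'b operations" and \<phi> :: "'a \<Rightarrow> 'b"
  assumes "C_infinity_ring A \<Phi>"
    and "C_infinity_congruence A \<Phi> R"
    and "C_infinity_ring B \<Psi>"
    and "C_infinity_hom A \<Phi> B \<Psi> \<phi>"
    and "R \<subseteq> hom_kernel A \<phi>"
  shows "\<exists>!\<phi>'. C_infinity_hom (A // R) (quotient_operations A \<Phi> R) B \<Psi> \<phi>' \<and>
               compose A \<phi>' (quotient_proj A R) = \<phi>"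
proof -
  have A: "C_infinity_structure A \<Phi>"
    using assms(1) by (simp add: C_infinity_ring_def)
  \<comment> \<open>Among maps that compose with \<open>q\<close> to \<open>\<phi>\<close>, being a
    homomorphism is equivalent to being a map into \<open>B\<close>, so unique existence
    transfers.\<close>
  have "C_infinity_hom (A // R) (quotient_operations A \<Phi> R) B \<Psi> \<phi>' \<and>
          compose A \<phi>' (quotient_proj A R) = \<phi> \<longleftrightarrow>
        \<phi>' \<in> A // R \<rightarrow>\<^sub>E B \<and> compose A \<phi>' (quotient_proj A R) = \<phi>" for \<phi>'
    using C_infinity_hom_of_compose[OF A assms(2,4)] by (auto simp: C_infinity_hom_def)
  moreover have "\<exists>!\<phi>'. \<phi>' \<in> A // R \<rightarrow>\<^sub>E B \<and> compose A \<phi>' (quotient_proj A R) = \<phi>"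
    using assms(2,4,5)
    by (intro quotient_map_unique_lift) (auto simp: C_infinity_congruence_def C_infinity_hom_def)
  ultimately show ?thesis
    by simp
qed

end
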